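(* For every fixed integer $n > 1$, $PD(X_b^n) \to 0$ as $b \to \infty$ (with $b$ ranging over integers $b > 1$).
   Context: For integers $b > 1$ and $n > 1$, let $X_b$ be a set of $b$ distinct elements, and let $X_b^n$ be the set of all multisets $X = \{x_1,\dots,x_n\}$ of cardinality $n$ (counted with multiplicity) whose elements lie in $X_b$. A multiset $X=\{x_1,\dots,x_n\} \in X_b^n$ is called palindromic if its elements can be arranged into a palindrome, i.e. there exist pairwise distinct indices $i_1,\dots,i_n \in \{1,\dots,n\}$ such that $(x_{i_1},\dots,x_{i_n}) = (x_{i_n},\dots,x_{i_1})$. Let $P_b^n \subset X_b^n$ be the set of palindromic multisets in $X_b^n$. The palindromic density of $X_b^n$ is $PD(X_b^n) := |P_b^n| / |X_b^n|$. *)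

theory Defs
  imports Complex_Main "HOL-Library.Multiset"
begin

definition palindromic :: "'a multiset \<Rightarrow> bool" where
  "palindromic M \<longleftrightarrow> (\<exists>xs. mset xs = M \<and> rev xs = xs)"

definition palindromic_multisets :: "'a set \<Rightarrow> nat \<Rightarrow> 'a multiset set" where
  "palindromic_multisets A n = {M \<in> multisets_of_size A n. palindromic M}"

definition palindromic_density :: "'a set \<Rightarrow> nat \<Rightarrow> real" where
  "palindromic_density A n =
     real (card (palindromic_multisets A n)) / real (card (multisets_of_size A n))"

end

theory Submission
  imports Defs
begin

text \<open>
  A palindrome of length \<open>n\<close> is determined by its first \<open>n - n div 2\<close> letters, because the
  remaining \<open>n div 2\<close> letters repeat the first ones in reverse order.  Over an alphabet of size
  \<open>b\<close> there are therefore at most \<open>b ^ (n - n div 2)\<close> palindromic multisets of size \<open>n\<close>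
  (\<open>card_palindromic_multisets_le\<close>).  On the other hand the number of all multisets of size \<open>n\<close>
  for fixed \<open>n\<close> grows like \<open>b ^ n\<close>: the sets among them alone number \<open>b choose n\<close>, which is at least
  \<open>(b / n) ^ n\<close> (\<open>card_multisets_of_size_ge\<close>).  The quotient is at most
  \<open>n ^ n / b ^ (n div 2)\<close>, and for \<open>n > 1\<close> the exponent \<open>n div 2\<close> is positive, so the density is
  \<open>O(1 / b)\<close>.
\<close>

text \<open>
  The first half includes the middle letter when the length is odd, whereas the reversed copy
  omits it; this is why only \<open>n div 2\<close> letters of the first half are repeated.
\<close>
lemma palindrome_eq_half_append_rev:
  assumes "rev xs = xs" and "length xs = n"
  shows "xs = take (n - n div 2) xs @ rev (take (n div 2) (take (n - n div 2) xs))"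
proof -
  have "drop (n - n div 2) xs = rev (take (n - (n - n div 2)) xs)"
    using drop_rev[of "n - n div 2" xs] assms by simp
  also have "n - (n - n div 2) = n div 2"
    by simp
  also have "take (n div 2) xs = take (n div 2) (take (n - n div 2) xs)"
    by (simp add: min_absorb1)
  finally show ?thesis
    by (metis append_take_drop_id)
qed

lemma card_palindromic_multisets_le:
  assumes "finite A"
  shows "card (palindromic_multisets A n) \<le> card A ^ (n - n div 2)"
proof -
  define L where "L = {ys. set ys \<subseteq> A \<and> length ys = n - n div 2}"
  define f where "f = (\<lambda>ys :: 'a list. mset (ys @ rev (take (n div 2) ys)))"
  have fin: "finite L"
    unfolding L_def using assms by (rule finite_lists_length_eq)
  have "palindromic_multisets A n \<subseteq> f ` L"
  proof
    fix M assume "M \<in> palindromic_multisets A n"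
    then obtain xs where xs: "mset xs = M" "rev xs = xs" "set xs \<subseteq> A" "length xs = n"
      by (auto simp: palindromic_multisets_def palindromic_def multisets_of_size_def)
    have "take (n - n div 2) xs \<in> L"
      using xs set_take_subset[of "n - n div 2" xs] by (auto simp: L_def)
    moreover have "M = f (take (n - n div 2) xs)"
      unfolding f_def using xs(1) palindrome_eq_half_append_rev[OF xs(2,4)] by metis
    ultimately show "M \<in> f ` L"
      by blast
  qed
  then have "card (palindromic_multisets A n) \<le> card L"
    using fin by (rule surj_card_le[rotated])
  also have "card L = card A ^ (n - n div 2)"
    unfolding L_def using assms by (rule card_lists_length_eq)
  finally show ?thesis .
qed

text \<open>
  Counting only the multisets without repetition loses a factor that depends on \<open>n\<close> alone,
  so the bound keeps the correct order of growth in the size of the alphabet.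
\<close>
lemma card_multisets_of_size_ge:
  assumes "finite A" and "n \<le> card A"
  shows "(real (card A) / real n) ^ n \<le> real (card (multisets_of_size A n))"
proof -
  have "inj_on mset_set {B. B \<subseteq> A \<and> card B = n}"
    using assms(1) by (intro inj_onI) (metis (mono_tags) finite_set_mset_mset_set
        finite_subset mem_Collect_eq)
  moreover have "mset_set ` {B. B \<subseteq> A \<and> card B = n} \<subseteq> multisets_of_size A n"
    using assms(1) by (auto simp: multisets_of_size_def finite_subset)
  moreover have "finite (multisets_of_size A n)"
    using assms(1) by (rule finite_multisets_of_size)
  ultimately have "card {B. B \<subseteq> A \<and> card B = n} \<le> card (multisets_of_size A n)"
    by (rule card_inj_on_le)
  then have "real (card A choose n) \<le> real (card (multisets_of_size A n))"
    using n_subsets[OF assms(1)] by simp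
  then show ?thesis
    using binomial_ge_n_over_k_pow_k[OF assms(2), where 'a = real] by linarith
qed

lemma palindromic_density_le:
  assumes "finite A" and "n \<le> card A" and "n > 0"
  shows "palindromic_density A n \<le> real n ^ n / real (card A) ^ (n div 2)"
proof -
  let ?b = "real (card A)"
  have b: "?b > 0"
    using assms by simp
  have "palindromic_density A n \<le> ?b ^ (n - n div 2) / (?b / real n) ^ n"
    unfolding palindromic_density_def
  proof (rule frac_le)
    show "real (card (palindromic_multisets A n)) \<le> ?b ^ (n - n div 2)"
      using card_palindromic_multisets_le[OF assms(1), of n] by (metis of_nat_le_iff of_nat_power)
    show "(?b / real n) ^ n \<le> real (card (multisets_of_size A n))"
      using assms by (intro card_multisets_of_size_ge)
  qed (use b assms in simp_all)
  also have "\<dots> = real n ^ n / ?b ^ (n div 2)"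
  proof -
    have "?b ^ n = ?b ^ (n - n div 2) * ?b ^ (n div 2)"
      by (simp flip: power_add)
    then show ?thesis
      using b by (simp add: power_divide)
  qed
  finally show ?thesis .
qed

theorem theorem5p1:
  fixes n :: nat and X :: "nat \<Rightarrow> 'a set"
  assumes "n > 1"
    and "\<And>b. b > 1 \<Longrightarrow> finite (X b) \<and> card (X b) = b"
  shows "(\<lambda>b. palindromic_density (X b) n) \<longlonglongrightarrow> 0"
proof (rule tendsto_sandwich)
  show "\<forall>\<^sub>F b in sequentially. 0 \<le> palindromic_density (X b) n"
    by (simp add: palindromic_density_def)
  show "\<forall>\<^sub>F b in sequentially. palindromic_density (X b) n \<le> real n ^ n / real b"
    using eventually_ge_at_top[of n]
  proof eventually_elim
    fix b assume "n \<le> b"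
    with assms have X: "finite (X b)" "card (X b) = b" and b: "real b \<ge> 1"
      by auto
    have "palindromic_density (X b) n \<le> real n ^ n / real b ^ (n div 2)"
      using palindromic_density_le[of "X b" n] X \<open>n \<le> b\<close> assms(1) by simp
    also have "\<dots> \<le> real n ^ n / real b"
      using b assms(1) by (intro divide_left_mono self_le_power) auto
    finally show "palindromic_density (X b) n \<le> real n ^ n / real b" .
  qed
  show "(\<lambda>b. real n ^ n / real b) \<longlonglongrightarrow> 0"
    by (rule lim_const_over_n)
qed simp

end
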